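(* Let $\mathcal{P}$ and $\mathcal{Q}$ be stationary ergodic discrete-time, discrete-alphabet stochastic processes. Given a hidden Markov model representation of $\mathcal{P}$ with transition probabilities $P(s_j,x|s_i)$ and one of $\mathcal{Q}$ with transition probabilities $Q(\tilde s_n,x|\tilde s_m)$, the co-emission divergence rate between them is given by $$R_C(\mathcal{P},\mathcal{Q})=-\frac12\log\left[\frac{\mu_{PQ}}{\sqrt{\mu_P}\sqrt{\mu_Q}}\right],$$ where $\mu_P$, $\mu_Q$ and $\mu_{PQ}$ are the leading eigenvalues of the transfer matrices $\mathbb{E}_{PP}$, $\mathbb{E}_{QQ}$ and $\mathbb{E}_{PQ}$, defined by $$(\mathbb{E}_{PQ})_{im,jn}:=\sum_x P(s_j,x|s_i)\,Q(\tilde s_n,x|\tilde s_m)$$ (and likewise for $\mathbb{E}_{PP}$ and $\mathbb{E}_{QQ}$, with both factors taken from the same model).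
   Context: A stochastic process $\mathcal{P}$ is a bi-infinite, discrete-time process producing at each time step an output $x$ from a discrete alphabet $\mathcal{A}$. The probability of $x_{t:t+L}:=x_t\cdots x_{t+L-1}$ is $P(x_{t:t+L})$ (and $Q(x_{t:t+L})$ for $\mathcal{Q}$). It is stationary if $P(x_{t:t+L})=P(x_{0:L})$ for all $t,L$. Processes with different alphabets are regarded as processes over a common alphabet. The co-emission probability is $C(P,Q;L)=\sum_{x_{0:L}\in\mathcal{A}^L}P(x_{0:L})Q(x_{0:L})$, and the co-emission divergence rate is $$R_C(\mathcal{P},\mathcal{Q})=-\lim_{L\to\infty}\frac{1}{2L}\log\left[\frac{C(P,Q;L)}{\sqrt{C(P,P;L)\,C(Q,Q;L)}}\right].$$ A hidden Markov model (HMM) representation of $\mathcal{P}$ consists of a finite set of hidden states $s_i$, with $P(s_j,x|s_i)$ the probability that, from state $s_i$, the model emits $x$ and moves to state $s_j$. With $\pi_i$ the stationary distribution over hidden states, $P(x_{0:L})=\sum_{i_0,\dots,i_L}\pi_{i_0}P(s_{i_1},x_0|s_{i_0})\cdots P(s_{i_L},x_{L-1}|s_{i_{L-1}})$. The representation of $\mathcal{Q}$ with states $\tilde s_m$ is analogous. The transfer matrices have rows indexed by pairs $(i,m)$ and columns by pairs $(j,n)$. The leading eigenvalue of such an entrywise non-negative matrix is its eigenvalue of largest magnitude, i.e. its spectral radius. Logarithms are base $2$, with $\log 0=-\infty$.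
   Formalization: Every hidden state of both hidden Markov models is assumed to have positive stationary probability; without this a transient state can raise a leading eigenvalue without affecting the process, and the formula fails. *)

theory Defs
  imports "HOL-Probability.Probability"
begin

text \<open>
  A bi-infinite process over the alphabet \<open>'a\<close> is a probability measure on the sequences
  \<open>int \<Rightarrow> 'a\<close> with the product of the discrete sigma-algebras. Two processes over different
  alphabets are compared by letting \<open>'a\<close> be a common one, since letters may have probability 0.
\<close>

definition seq_algebra :: "(int \<Rightarrow> 'a) measure" where
  "seq_algebra = (\<Pi>\<^sub>M t\<in>UNIV. count_space UNIV)"

definition process :: "(int \<Rightarrow> 'a) measure \<Rightarrow> bool" where
  "process M \<longleftrightarrow> prob_space M \<and> sets M = sets seq_algebra"

definition word_prob_at :: "(int \<Rightarrow> 'a) measure \<Rightarrow> int \<Rightarrow> 'a list \<Rightarrow> real" where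
  "word_prob_at M t w = measure M {\<omega> \<in> space M. \<forall>k<length w. \<omega> (t + int k) = w ! k}"

abbreviation word_prob :: "(int \<Rightarrow> 'a) measure \<Rightarrow> 'a list \<Rightarrow> real" where
  "word_prob M \<equiv> word_prob_at M 0"

definition stationary :: "(int \<Rightarrow> 'a) measure \<Rightarrow> bool" where
  "stationary M \<longleftrightarrow> (\<forall>t w. word_prob_at M t w = word_prob_at M 0 w)"

definition shift :: "(int \<Rightarrow> 'a) \<Rightarrow> (int \<Rightarrow> 'a)" where
  "shift \<omega> = (\<lambda>t. \<omega> (t + 1))"

definition ergodic :: "(int \<Rightarrow> 'a) measure \<Rightarrow> bool" where
  "ergodic M \<longleftrightarrow> (\<forall>A\<in>sets M. shift -` A \<inter> space M = A \<longrightarrow> measure M A = 0 \<or> measure M A = 1)"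

text \<open>The base-2 logarithm on nonnegative reals, with \<open>log 0 = -\<infinity>\<close>.\<close>

definition elog2 :: "real \<Rightarrow> ereal" where
  "elog2 x = (if x = 0 then -\<infinity> else ereal (log 2 x))"

definition coemission_prob ::
  "(int \<Rightarrow> 'a) measure \<Rightarrow> (int \<Rightarrow> 'a) measure \<Rightarrow> nat \<Rightarrow> real" where
  "coemission_prob P Q L = (\<Sum>\<^sub>\<infinity>w\<in>{w. length w = L}. word_prob P w * word_prob Q w)"

definition coemission_rate_seq ::
  "(int \<Rightarrow> 'a) measure \<Rightarrow> (int \<Rightarrow> 'a) measure \<Rightarrow> nat \<Rightarrow> ereal" where
  "coemission_rate_seq P Q L =
     ereal (1 / (2 * real L)) *
     elog2 (coemission_prob P Q L / sqrt (coemission_prob P P L * coemission_prob Q Q L))"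

definition coemission_divergence_rate ::
  "(int \<Rightarrow> 'a) measure \<Rightarrow> (int \<Rightarrow> 'a) measure \<Rightarrow> ereal" where
  "coemission_divergence_rate P Q = - lim (coemission_rate_seq P Q)"

text \<open>
  A hidden Markov model with state type \<open>'s\<close> is given by its kernel \<open>T :: 's \<Rightarrow> ('s \<times> 'a) pmf\<close>:
  \<open>pmf (T i) (j, x)\<close> is the probability, from state \<open>i\<close>, of emitting \<open>x\<close> and moving to \<open>j\<close>.
\<close>

definition stationary_distribution :: "('s \<Rightarrow> ('s \<times> 'a) pmf) \<Rightarrow> 's pmf \<Rightarrow> bool" where
  "stationary_distribution T \<pi> \<longleftrightarrow> bind_pmf \<pi> (\<lambda>i. map_pmf fst (T i)) = \<pi>"

text \<open>
  Besides \<open>stationary_distribution\<close>, positivity of \<open>\<pi>\<close> matters: a state with \<open>\<pi>\<close>-probability 0 is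
  transient and never occurs in the bi-infinite stationary process, so it has no influence on word
  probabilities, yet it can raise the leading eigenvalue of the transfer matrix. The condition
  \<open>\<forall>i. pmf \<pi> i > 0\<close> is not part of \<open>hmm_representation\<close> below and has to be assumed separately.
\<close>

text \<open>The list \<open>h\<close> is the sequence of hidden states visited while the word \<open>w\<close> is emitted.\<close>

definition hmm_word_prob ::
  "('s::finite \<Rightarrow> ('s \<times> 'a) pmf) \<Rightarrow> 's pmf \<Rightarrow> 'a list \<Rightarrow> real" where
  "hmm_word_prob T \<pi> w =
     (\<Sum>h\<in>{h. length h = Suc (length w)}.
        pmf \<pi> (h ! 0) * (\<Prod>k<length w. pmf (T (h ! k)) (h ! Suc k, w ! k)))"

definition hmm_representation ::
  "('s::finite \<Rightarrow> ('s \<times> 'a) pmf) \<Rightarrow> 's pmf \<Rightarrow> (int \<Rightarrow> 'a) measure \<Rightarrow> bool" where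
  "hmm_representation T \<pi> M \<longleftrightarrow>
     stationary_distribution T \<pi> \<and> (\<forall>w. word_prob M w = hmm_word_prob T \<pi> w)"

definition transfer_matrix ::
  "('s::finite \<Rightarrow> ('s \<times> 'a) pmf) \<Rightarrow> ('t::finite \<Rightarrow> ('t \<times> 'a) pmf) \<Rightarrow> real ^ ('s \<times> 't) ^ ('s \<times> 't)"
where
  "transfer_matrix T U =
     (\<chi> r c. \<Sum>\<^sub>\<infinity>x. pmf (T (fst r)) (fst c, x) * pmf (U (snd r)) (snd c, x))"

definition is_eigenvalue :: "complex ^ 'n ^ 'n \<Rightarrow> complex \<Rightarrow> bool" where
  "is_eigenvalue A \<mu> \<longleftrightarrow> (\<exists>v. v \<noteq> 0 \<and> A *v v = \<mu> *s v)"

text \<open>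
  For an entrywise nonnegative matrix the spectral radius is itself an eigenvalue, hence it is
  the eigenvalue of largest magnitude.
\<close>

definition leading_eigenvalue :: "real ^ 'n ^ 'n \<Rightarrow> real" where
  "leading_eigenvalue A = Max {norm \<mu> | \<mu>. is_eigenvalue (map_matrix complex_of_real A) \<mu>}"

end

(*
The words of length L of two hidden Markov models have co-emission probability
C(P,Q;L) = sum over r of w_r (E^L 1)_r, where E is the transfer matrix and w_(i,m) = pi_i rho_m is
strictly positive. Let mu be the largest modulus of an eigenvalue of E. If v is an eigenvector for
an eigenvalue of modulus mu, then mu |v| <= E |v| entrywise, whence C(P,Q;L) >= c mu^L with c > 0.
Conversely, E^L 1 = O(s^L) for each s > mu, because the vector 1 is annihilated by a polynomial in E
whose linear factors can be peeled off one at a time. Hence log C(P,Q;L) / L tends to log mu when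
mu > 0; when mu = 0 the same peeling shows that E is nilpotent, so that C(P,Q;L) vanishes
eventually and both sides of the claim are infinite. A process has C(P,P;L) > 0 for all L, so the
two self-terms never vanish.
*)
theory Submission
  imports Defs "HOL-Computational_Algebra.Fundamental_Theorem_Algebra"
begin

section \<open>Polynomials in a matrix and the growth of its powers\<close>

text \<open>The Horner scheme for p(A) v. It acts on vectors because \<open>*\<close> on
  \<open>complex ^ 'n ^ 'n\<close> is the componentwise product, not composition.\<close>

definition poly_act :: "complex ^ 'n ^ 'n \<Rightarrow> complex poly \<Rightarrow> complex ^ 'n \<Rightarrow> complex ^ 'n" where
  "poly_act A p v = fold_coeffs (\<lambda>a u. a *s v + A *v u) p 0"

lemma poly_act_0 [simp]: "poly_act A 0 v = 0"
  by (simp add: poly_act_def)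

lemma poly_act_pCons [simp]: "poly_act A (pCons a p) v = a *s v + A *v poly_act A p v"
  by (cases "p = 0 \<and> a = 0") (auto simp: poly_act_def)

lemma poly_act_add: "poly_act A (p + q) v = poly_act A p v + poly_act A q v"
  by (induction p q rule: poly_induct2)
    (simp_all add: vec.scale_left_distrib matrix_vector_right_distrib algebra_simps)

lemma poly_act_smult: "poly_act A (smult c p) v = c *s poly_act A p v"
  by (induction p) (simp_all add: vec.scale_right_distrib vec.scale)

lemma poly_act_mult: "poly_act A (p * q) v = poly_act A p (poly_act A q v)"
  by (induction p) (simp_all add: poly_act_add poly_act_smult)

lemma poly_act_right_linear: "Vector_Spaces.linear (*s) (*s) (poly_act A p)"
proof (induction p)
  case 0
  then show ?case by (simp add: vec.linear_zero)
next
  case (pCons a p)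
  have "poly_act A (pCons a p) = (\<lambda>v. a *s v + A *v poly_act A p v)" by auto
  then show ?case
    using vec.linear_compose_add[OF vec.linear_scale_self[of a]
        Vector_Spaces.linear_compose[OF pCons(2) matrix_vector_mul_linear_gen[of A]]]
    by (simp add: o_def)
qed

lemma poly_act_sum: "poly_act A (sum f S) v = (\<Sum>i\<in>S. poly_act A (f i) v)"
  by (induction S rule: infinite_finite_induct) (simp_all add: poly_act_add)

lemma poly_act_monom: "poly_act A (monom c i) v = c *s (((*v) A ^^ i) v)"
  by (induction i) (simp_all add: monom_0 monom_Suc vec.scale)

text \<open>The n + 1 vectors v, A v, ..., A^n v live in dimension n, so they are linearly
  dependent, and a dependence is a polynomial. Dependence is a property of sets, so a repetition
  among these vectors is a separate case.\<close>

lemma ex_poly_act_eq_0: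
  fixes A :: "complex ^ 'n ^ 'n"
  shows "\<exists>p. p \<noteq> 0 \<and> poly_act A p v = 0"
proof -
  let ?n = "CARD('n)" and ?f = "\<lambda>i. ((*v) A ^^ i) v"
  show ?thesis
  proof (cases "inj_on ?f {..?n}")
    case True
    have "card (?f ` {..?n}) = Suc ?n" using True by (simp add: card_image)
    moreover have "card B \<le> ?n" if "vec.independent B" for B :: "(complex ^ 'n) set"
      using vec.dim_eq_card_independent[OF that] vec.dim_subset_UNIV[of B]
      by (simp add: vec.dimension_def card_cart_basis)
    ultimately have "vec.dependent (?f ` {..?n})" by (metis Suc_n_not_le_n)
    then obtain u w where u: "(\<Sum>w\<in>?f ` {..?n}. u w *s w) = 0" "w \<in> ?f ` {..?n}" "u w \<noteq> 0"
      by (auto simp: vec.dependent_finite)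
    let ?p = "\<Sum>i\<le>?n. monom (u (?f i)) i"
    have "poly_act A ?p v = 0"
      using u(1) True by (simp add: poly_act_sum poly_act_monom sum.reindex)
    moreover have "?p \<noteq> 0"
    proof -
      obtain k where "k \<le> ?n" "w = ?f k" using u by auto
      then have "coeff ?p k \<noteq> 0" using u by (simp add: coeff_sum sum.delta if_distrib)
      then show ?thesis by force
    qed
    ultimately show ?thesis by blast
  next
    case False
    then obtain i j where "i \<noteq> j" "?f i = ?f j" by (auto simp: inj_on_def)
    then have "poly_act A (monom 1 i - monom 1 j) v = 0"
      by (metis add_uminus_conv_diff poly_act_add poly_act_monom minus_monom vec.scale_minus_left right_minus vec.scale_one)
    moreover have "monom (1::complex) i - monom 1 j \<noteq> 0"
      using \<open>i \<noteq> j\<close> by (metis eq_iff_diff_eq_0 coeff_monom one_neq_zero)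
    ultimately show ?thesis by blast
  qed
qed

text \<open>A weak form of Cayley-Hamilton: the product of polynomials annihilating the single basis
  vectors annihilates all of them, hence everything by linearity.\<close>

lemma ex_annihilating_poly: "\<exists>p. p \<noteq> 0 \<and> (\<forall>v. poly_act A p v = 0)"
proof -
  from ex_poly_act_eq_0 obtain q where q: "\<And>v. q v \<noteq> 0" "\<And>v. poly_act A (q v) v = 0"
    by metis
  let ?p = "\<Prod>k\<in>UNIV. q (axis k 1)"
  interpret Vector_Spaces.linear "(*s)" "(*s)" "poly_act A ?p"
    by (rule poly_act_right_linear)
  have "poly_act A ?p (axis k 1) = 0" for k
  proof -
    \<comment> \<open>Polynomials in A commute, so the factor that annihilates
      \<open>axis k 1\<close> can be made to act first.\<close>
    have "?p = (\<Prod>l\<in>UNIV - {k}. q (axis l 1)) * q (axis k 1)"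
      by (simp add: prod.remove[of UNIV k] mult.commute)
    then have "poly_act A ?p (axis k 1) =
        poly_act A (\<Prod>l\<in>UNIV - {k}. q (axis l 1)) (poly_act A (q (axis k 1)) (axis k 1))"
      by (simp add: poly_act_mult)
    also have "\<dots> = 0"
      unfolding q by (metis poly_act_right_linear vec.linear_0)
    finally show ?thesis .
  qed
  then have "poly_act A ?p v = 0" for v
    by (subst basis_expansion[of v, symmetric]) (simp add: sum scale)
  moreover have "?p \<noteq> 0" using q by simp
  ultimately show ?thesis by blast
qed

section \<open>Eigenvalues and annihilating polynomials\<close>

lemma poly_act_eigenvector:
  assumes "A *v v = \<mu> *s v"
  shows "poly_act A p v = poly p \<mu> *s v"
  by (induction p) (simp_all add: assms vec.scale vec.scale_left_distrib mult.commute)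

text \<open>Every eigenvalue is a root of any nonzero polynomial that annihilates all
  vectors.\<close>

lemma finite_eigenvalues: "finite {\<mu>. is_eigenvalue A \<mu>}"
proof -
  obtain p where p: "p \<noteq> 0" "\<And>v. poly_act A p v = 0"
    using ex_annihilating_poly by blast
  have "{\<mu>. is_eigenvalue A \<mu>} \<subseteq> {\<mu>. poly p \<mu> = 0}"
    using p by (auto simp: is_eigenvalue_def poly_act_eigenvector dest!: poly_act_eigenvector[of A _ _ p])
  then show ?thesis using poly_roots_finite[OF p(1)] finite_subset by blast
qed

text \<open>
  A polynomial annihilating \<open>v\<close> splits into linear factors \<open>A - \<mu>\<close>. A factor for a non-eigenvalue
  \<open>\<mu>\<close> is injective and can be cancelled; the others are peeled off one by one.
\<close>

lemma eigenvalue_shift_induct [case_names zero shift]: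
  fixes A :: "complex ^ 'n ^ 'n"
  assumes zero: "S 0"
    and shift: "\<And>v \<mu>. is_eigenvalue A \<mu> \<Longrightarrow> S (A *v v - \<mu> *s v) \<Longrightarrow> S v"
  shows "S v"
proof -
  have "S v" if "p \<noteq> 0" "poly_act A p v = 0" for p v
    using that
  proof (induction "degree p" arbitrary: p v)
    case 0
    then obtain c where "p = [:c:]" "c \<noteq> 0" by (metis degree_eq_zeroE pCons_0_0)
    then show ?case using 0 zero by simp
  next
    case (Suc d)
    then have "\<not> constant (poly p)" by (simp add: constant_degree)
    then obtain \<mu> where "poly p \<mu> = 0" using fundamental_theorem_of_algebra by blast
    then obtain q where q: "p = [:-\<mu>, 1:] * q" by (auto simp: poly_eq_0_iff_dvd elim: dvdE)
    then have q0: "q \<noteq> 0" and d: "d = degree q"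
      using Suc by (auto simp: degree_mult_eq simp del: mult_pCons_left)
    let ?u = "poly_act A q v"
    have u: "A *v ?u = \<mu> *s ?u"
      using Suc.prems(2) by (simp add: q poly_act_mult del: mult_pCons_left)
    \<comment> \<open>If \<open>?u\<close> vanishes, \<open>q\<close> already annihilates v and the
      factor is cancelled; this covers every non-eigenvalue. Otherwise \<open>?u\<close> is an
      eigenvector, and \<open>q\<close> annihilates the shifted vector.\<close>
    show ?case
    proof (cases "?u = 0")
      case True
      then show ?thesis using Suc.hyps(1)[OF d q0] by blast
    next
      case False
      then have ev: "is_eigenvalue A \<mu>" using u by (auto simp: is_eigenvalue_def)
      have "poly_act A q (A *v v - \<mu> *s v) = poly_act A (q * [:-\<mu>, 1:]) v"
        by (simp add: poly_act_mult del: mult_pCons_right)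
      also have "\<dots> = 0" using Suc.prems(2) q by (simp add: mult.commute)
      finally show ?thesis using shift[OF ev] Suc.hyps(1)[OF d q0] by blast
    qed
  qed
  then show ?thesis using ex_poly_act_eq_0 by blast
qed

text \<open>Without eigenvalues the shift case of the induction is vacuous, and every vector would
  be 0.\<close>

lemma ex_eigenvalue:
  fixes A :: "complex ^ 'n ^ 'n"
  shows "\<exists>\<mu>. is_eigenvalue A \<mu>"
proof (rule ccontr)
  assume "\<nexists>\<mu>. is_eigenvalue A \<mu>"
  then have "v = 0" for v :: "complex ^ 'n"
    by (induction v rule: eigenvalue_shift_induct[of _ A]) auto
  then show False using zero_neq_one by metis
qed

section \<open>Growth of the iterates of a complex matrix\<close>

lemma norm_vector_smult: "norm (c *s v) = norm c * norm v" for v :: "complex ^ 'n"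
  by (simp add: norm_vec_def L2_set_right_distrib norm_mult)

lemma funpow_matrix_vector_diff:
  fixes A :: "complex ^ 'n ^ 'n"
  shows "((*v) A ^^ L) (x - c *s y) = ((*v) A ^^ L) x - c *s ((*v) A ^^ L) y"
  by (induction L) (simp_all add: vec.scale matrix_vector_mult_diff_distrib)

text \<open>A bound for u = A v - mu v passes to v through A^(L+1) v = mu A^L v + A^L u. The strict
  gap between the moduli and s absorbs the polynomial factors that Jordan blocks produce.\<close>

lemma funpow_matrix_vector_growth:
  fixes A :: "complex ^ 'n ^ 'n"
  assumes s: "\<And>\<mu>. is_eigenvalue A \<mu> \<Longrightarrow> norm \<mu> < s"
  shows "\<exists>K. \<forall>L. norm (((*v) A ^^ L) v) \<le> K * s ^ L"
proof (induction v rule: eigenvalue_shift_induct[of _ A])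
  case zero
  have "((*v) A ^^ L) 0 = 0" for L by (induction L) simp_all
  then show ?case by (intro exI[of _ 0]) simp
next
  case (shift v \<mu>)
  let ?X = "\<lambda>L. ((*v) A ^^ L) v" and ?Y = "\<lambda>L. ((*v) A ^^ L) (A *v v - \<mu> *s v)"
  obtain K where K: "\<And>L. norm (?Y L) \<le> K * s ^ L" using shift(2) by blast
  have lt: "norm \<mu> < s" using s shift(1) by blast
  then have s0: "s > 0" using norm_ge_zero[of \<mu>] by linarith
  \<comment> \<open>\<open>K'\<close> solves \<open>norm \<mu> * K' + K \<le> K' * s\<close>, which closes the recursion for \<open>A\<^sup>L v\<close> below.\<close>
  define K' where "K' = max (norm v) (K / (s - norm \<mu>))"
  have K': "norm \<mu> * K' + K \<le> K' * s"
  proof -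
    have "K / (s - norm \<mu>) \<le> K'" by (simp add: K'_def)
    then show ?thesis using lt by (simp add: pos_divide_le_eq algebra_simps)
  qed
  have "norm (?X L) \<le> K' * s ^ L" for L
  proof (induction L)
    case 0
    then show ?case by (simp add: K'_def)
  next
    case (Suc L)
    have "?X (Suc L) = \<mu> *s ?X L + ?Y L"
      by (simp only: funpow_matrix_vector_diff funpow_Suc_right o_apply) simp
    then have "norm (?X (Suc L)) \<le> norm \<mu> * norm (?X L) + norm (?Y L)"
      by (metis norm_triangle_ineq norm_vector_smult)
    also have "\<dots> \<le> norm \<mu> * (K' * s ^ L) + K * s ^ L"
      using Suc K by (intro add_mono mult_left_mono) auto
    also have "\<dots> = (norm \<mu> * K' + K) * s ^ L" by (simp add: algebra_simps)
    also have "\<dots> \<le> K' * s * s ^ L"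
      using K' s0 by (intro mult_right_mono) auto
    finally show ?case by (simp add: algebra_simps)
  qed
  then show ?case by blast
qed

text \<open>Growth bounds with s > 0 never yield exact vanishing. Here each shift is just v to A v,
  so every peeled factor costs one more power of A.\<close>

lemma funpow_matrix_vector_nilpotent:
  fixes A :: "complex ^ 'n ^ 'n"
  assumes "\<And>\<mu>. is_eigenvalue A \<mu> \<Longrightarrow> \<mu> = 0"
  shows "\<exists>N. \<forall>L\<ge>N. ((*v) A ^^ L) v = 0"
proof (induction v rule: eigenvalue_shift_induct[of _ A])
  case zero
  have "((*v) A ^^ L) 0 = 0" for L by (induction L) simp_all
  then show ?case by simp
next
  case (shift v \<mu>)
  then obtain N where N: "\<And>L. L \<ge> N \<Longrightarrow> ((*v) A ^^ L) (A *v v) = 0"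
    using assms[of \<mu>] by auto
  have "((*v) A ^^ L) v = 0" if "L \<ge> Suc N" for L
    using that N[of "L - 1"] by (cases L) (simp_all add: funpow_Suc_right del: funpow.simps)
  then show ?case by blast
qed

section \<open>Real matrices and their leading eigenvalue\<close>

definition cvec :: "real ^ 'n \<Rightarrow> complex ^ 'n" where
  "cvec x = (\<chi> i. complex_of_real (x $ i))"

lemma cvec_nth [simp]: "cvec x $ i = complex_of_real (x $ i)"
  by (simp add: cvec_def)

lemma cvec_funpow:
  fixes E :: "real ^ 'n ^ 'n"
  shows "cvec (((*v) E ^^ L) x) = ((*v) (map_matrix complex_of_real E) ^^ L) (cvec x)"
proof (induction L)
  case (Suc L)
  have "cvec (E *v y) = map_matrix complex_of_real E *v cvec y" for y
    by (simp add: vec_eq_iff matrix_vector_mult_def)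
  then show ?case using Suc by simp
qed simp

text \<open>\<open>Max\<close> is meaningful here because the set of eigenvalues is finite and
  nonempty.\<close>

lemma leading_eigenvalue_attained:
  "\<exists>\<mu>. is_eigenvalue (map_matrix complex_of_real E) \<mu> \<and> norm \<mu> = leading_eigenvalue E"
proof -
  let ?A = "map_matrix complex_of_real E"
  have "{norm \<mu> | \<mu>. is_eigenvalue ?A \<mu>} = norm ` {\<mu>. is_eigenvalue ?A \<mu>}" by auto
  then have "leading_eigenvalue E \<in> norm ` {\<mu>. is_eigenvalue ?A \<mu>}"
    using Max_in[of "norm ` {\<mu>. is_eigenvalue ?A \<mu>}"] finite_eigenvalues[of ?A] ex_eigenvalue[of ?A]
    by (auto simp: leading_eigenvalue_def)
  then show ?thesis by auto
qed

lemma norm_eigenvalue_le_leading: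
  assumes "is_eigenvalue (map_matrix complex_of_real E) \<mu>"
  shows "norm \<mu> \<le> leading_eigenvalue E"
proof -
  let ?A = "map_matrix complex_of_real E"
  have "{norm \<mu> | \<mu>. is_eigenvalue ?A \<mu>} = norm ` {\<mu>. is_eigenvalue ?A \<mu>}" by auto
  then show ?thesis
    using finite_eigenvalues[of ?A] assms by (simp add: leading_eigenvalue_def)
qed

lemma leading_eigenvalue_nonneg: "leading_eigenvalue E \<ge> 0"
  using leading_eigenvalue_attained[of E] by (metis norm_ge_zero)

section \<open>Nonnegative matrices\<close>

text \<open>The vector \<open>1\<close> has all entries 1, so this is the product w^T E^L 1. With
  products of stationary probabilities as weights it becomes the co-emission probability.\<close>

definition total_mass :: "('n \<Rightarrow> real) \<Rightarrow> real ^ 'n ^ 'n \<Rightarrow> nat \<Rightarrow> real" where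
  "total_mass w E L = (\<Sum>r\<in>UNIV. w r * (((*v) E ^^ L) 1) $ r)"

lemma funpow_nonneg_matrix_mono:
  fixes E :: "real ^ 'n ^ 'n"
  assumes E: "\<And>r c. E $ r $ c \<ge> 0" and "\<And>r. x $ r \<le> y $ r"
  shows "(((*v) E ^^ L) x) $ r \<le> (((*v) E ^^ L) y) $ r"
  using assms(2)
  by (induction L arbitrary: r)
    (auto simp: matrix_vector_mult_def intro!: sum_mono mult_left_mono E)

text \<open>The eigenvector is only known to be nonzero at some coordinate r. Positivity of
  \<open>w\<close> everywhere, in place of irreducibility of E, ensures that growth at r is seen in
  the total.\<close>

lemma total_mass_lower:
  fixes E :: "real ^ 'n ^ 'n"
  assumes E: "\<And>r c. E $ r $ c \<ge> 0" and w: "\<And>r. w r > 0"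
  shows "\<exists>c>0. \<forall>L. c * leading_eigenvalue E ^ L \<le> total_mass w E L"
proof -
  let ?A = "map_matrix complex_of_real E" and ?m = "leading_eigenvalue E"
  obtain \<mu> v where \<mu>: "norm \<mu> = ?m" and v: "v \<noteq> 0" "?A *v v = \<mu> *s v"
    using leading_eigenvalue_attained[of E] by (auto simp: is_eigenvalue_def)
  obtain r where r: "v $ r \<noteq> 0" using v(1) by (auto simp: vec_eq_iff)
  define B where "B = Max (range (\<lambda>i. norm (v $ i)))"
  have B: "norm (v $ i) \<le> B" for i by (simp add: B_def)
  have B0: "B > 0" using B[of r] r by (smt (verit) zero_less_norm_iff)
  \<comment> \<open>The entrywise modulus of \<open>v\<close>, scaled to be at most 1, is a subeigenvector of \<open>E\<close> for \<open>?m\<close>.\<close>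
  let ?x = "\<chi> i. norm (v $ i) / B"
  have pow: "?m ^ L * ?x $ i \<le> (((*v) E ^^ L) ?x) $ i" for L i
  proof (induction L arbitrary: i)
    case (Suc L)
    have m: "?m ^ Suc L * ?x $ i = ?m ^ L * (?m * ?x $ i)" by simp
    have "?m * ?x $ i = norm ((?A *v v) $ i) / B"
      by (simp add: v(2) norm_mult \<mu>)
    also have "\<dots> \<le> (\<Sum>j\<in>UNIV. norm (?A $ i $ j * v $ j)) / B"
      using B0 by (simp add: matrix_vector_mult_def norm_sum divide_right_mono del: nth_map_matrix)
    also have "\<dots> = (\<Sum>j\<in>UNIV. E $ i $ j * ?x $ j)"
      by (simp add: norm_mult E sum_divide_distrib)
    finally have "?m * ?x $ i \<le> (\<Sum>j\<in>UNIV. E $ i $ j * ?x $ j)" .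
    then have "?m ^ L * (?m * ?x $ i) \<le> ?m ^ L * (\<Sum>j\<in>UNIV. E $ i $ j * ?x $ j)"
      using leading_eigenvalue_nonneg[of E] by (intro mult_left_mono) simp_all
    also have "\<dots> = (\<Sum>j\<in>UNIV. E $ i $ j * (?m ^ L * ?x $ j))"
      by (simp add: sum_distrib_left mult_ac)
    also have "\<dots> \<le> (\<Sum>j\<in>UNIV. E $ i $ j * (((*v) E ^^ L) ?x) $ j)"
      by (intro sum_mono mult_left_mono Suc E)
    also have "\<dots> = (((*v) E ^^ Suc L) ?x) $ i" by (simp add: matrix_vector_mult_def)
    finally show ?case unfolding m .
  qed simp
  have one: "(((*v) E ^^ L) ?x) $ i \<le> (((*v) E ^^ L) 1) $ i" for L i
    using B B0 by (intro funpow_nonneg_matrix_mono E) simp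
  have nonneg: "0 \<le> (((*v) E ^^ L) 1) $ i" for L i
    by (induction L arbitrary: i)
      (auto simp: matrix_vector_mult_def intro!: sum_nonneg mult_nonneg_nonneg E)
  have "w r * ?x $ r * ?m ^ L \<le> total_mass w E L" for L
  proof -
    have "w r * ?x $ r * ?m ^ L = w r * (?m ^ L * ?x $ r)" by simp
    also have "\<dots> \<le> w r * (((*v) E ^^ L) 1) $ r"
      using order_trans[OF pow one] w[of r] by (intro mult_left_mono) simp_all
    also have "\<dots> \<le> total_mass w E L"
      unfolding total_mass_def
      using nonneg less_imp_le[OF w] by (intro member_le_sum) simp_all
    finally show ?thesis .
  qed
  moreover have "w r * ?x $ r > 0" using w r B0 by simp
  ultimately show ?thesis by blast
qed

lemma total_mass_upper:
  assumes w: "\<And>r. w r > 0" and s: "leading_eigenvalue E < s"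
  shows "\<exists>K. \<forall>L. total_mass w E L \<le> K * s ^ L"
proof -
  let ?A = "map_matrix complex_of_real E"
  obtain K where K: "\<And>L. norm (((*v) ?A ^^ L) (cvec 1)) \<le> K * s ^ L"
    using funpow_matrix_vector_growth[of ?A s "cvec 1"] norm_eigenvalue_le_leading s
    by (meson le_less_trans)
  have "total_mass w E L \<le> (\<Sum>r\<in>UNIV. w r) * K * s ^ L" for L
  proof -
    have "(((*v) E ^^ L) 1) $ r \<le> K * s ^ L" for r
    proof -
      have "(((*v) E ^^ L) 1) $ r \<le> norm (cvec (((*v) E ^^ L) 1) $ r)" by simp
      also have "\<dots> \<le> norm (cvec (((*v) E ^^ L) 1))" by (rule Finite_Cartesian_Product.norm_nth_le)
      also have "\<dots> \<le> K * s ^ L" using K by (simp add: cvec_funpow)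
      finally show ?thesis .
    qed
    then have "total_mass w E L \<le> (\<Sum>r\<in>UNIV. w r * (K * s ^ L))"
      unfolding total_mass_def using w by (intro sum_mono mult_left_mono) (auto intro: less_imp_le)
    then show ?thesis by (simp add: sum_distrib_right mult.assoc)
  qed
  then show ?thesis by blast
qed

lemma total_mass_eventually_0:
  assumes "leading_eigenvalue E = 0"
  shows "\<forall>\<^sub>F L in sequentially. total_mass w E L = 0"
proof -
  let ?A = "map_matrix complex_of_real E"
  have "\<mu> = 0" if "is_eigenvalue ?A \<mu>" for \<mu>
    using norm_eigenvalue_le_leading[OF that] assms by simp
  then obtain N where N: "\<And>L. L \<ge> N \<Longrightarrow> ((*v) ?A ^^ L) (cvec 1) = 0"
    using funpow_matrix_vector_nilpotent[of ?A "cvec 1"] by blast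
  have "total_mass w E L = 0" if "L \<ge> N" for L
  proof -
    have "cvec (((*v) E ^^ L) 1) = 0" using N[OF that] by (simp add: cvec_funpow)
    then have "((*v) E ^^ L) 1 = 0" by (simp add: vec_eq_iff)
    then show ?thesis by (simp add: total_mass_def)
  qed
  then show ?thesis by (auto simp: eventually_sequentially)
qed

text \<open>The constant K depends on s and may blow up as s approaches m, so there is no single
  upper sequence to squeeze with. Each a above the limit gets its own s.\<close>

lemma log_over_n_tendsto:
  fixes f :: "nat \<Rightarrow> real"
  assumes m: "m > 0" and c: "c > 0" and lower: "\<And>L. c * m ^ L \<le> f L"
    and upper: "\<And>s. s > m \<Longrightarrow> \<exists>K. \<forall>L. f L \<le> K * s ^ L"
  shows "(\<lambda>L. log 2 (f L) / real L) \<longlonglongrightarrow> log 2 m"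
proof (rule order_tendstoI)
  have pos: "f L > 0" for L using m c lower[of L] by (smt (verit) mult_pos_pos zero_less_power)
  have lim: "(\<lambda>L. log 2 k / real L + log 2 s) \<longlonglongrightarrow> log 2 s" for k s
    by (rule tendsto_eq_intros tendsto_divide_0 tendsto_const filterlim_real_sequentially refl
        filterlim_at_top_imp_at_infinity)+ simp
  have split: "log 2 (k * s ^ L) / real L = log 2 k / real L + log 2 s"
    if "k > 0" "s > 0" "L > 0" for k s L
    using that by (simp add: log_mult log_nat_power add_divide_distrib)
  {
    fix a assume "a < log 2 m"
    with lim have "\<forall>\<^sub>F L in sequentially. a < log 2 c / real L + log 2 m"
      by (rule order_tendstoD)
    then show "\<forall>\<^sub>F L in sequentially. a < log 2 (f L) / real L"
      using eventually_gt_at_top[of 0]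
    proof eventually_elim
      case (elim L)
      have "log 2 (c * m ^ L) / real L \<le> log 2 (f L) / real L"
        using lower c m pos by (intro divide_right_mono) simp_all
      then show ?case using elim split[OF c m, of L] by simp
    qed
  next
    fix a assume a: "log 2 m < a"
    \<comment> \<open>\<open>log 2 s\<close> is the midpoint of \<open>log 2 m\<close> and
      a.\<close>
    define s where "s = 2 powr ((a + log 2 m) / 2)"
    have s: "log 2 s < a" "s > 0" using a by (simp_all add: s_def)
    have "log 2 m < log 2 s" using a by (simp add: s_def)
    then have "m < s" using m s by simp
    then obtain K where K: "\<And>L. f L \<le> K * s ^ L" using upper by blast
    \<comment> \<open>At L = 0 the bound reads f 0 <= K.\<close>
    have K0: "K > 0" using K[of 0] pos[of 0] by simp
    have "\<forall>\<^sub>F L in sequentially. log 2 K / real L + log 2 s < a"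
      using lim s(1) by (rule order_tendstoD)
    then show "\<forall>\<^sub>F L in sequentially. log 2 (f L) / real L < a"
      using eventually_gt_at_top[of 0]
    proof eventually_elim
      case (elim L)
      have "log 2 (f L) / real L \<le> log 2 (K * s ^ L) / real L"
        using K pos K0 s by (intro divide_right_mono) simp_all
      then show ?case using elim split[OF K0 s(2), of L] by simp
    qed
  }
qed

section \<open>Word probabilities\<close>

text \<open>The probability of a word given the initial state. Recursion on the first letter
  replaces the sum over hidden paths and matches one multiplication by the transfer matrix from the
  left.\<close>

fun state_word_prob :: "('s::finite \<Rightarrow> ('s \<times> 'a) pmf) \<Rightarrow> 's \<Rightarrow> 'a list \<Rightarrow> real" where
  "state_word_prob T i [] = 1"
| "state_word_prob T i (x # w) = (\<Sum>j\<in>UNIV. pmf (T i) (j, x) * state_word_prob T j w)"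

lemma state_word_prob_nonneg: "state_word_prob T i w \<ge> 0"
  by (induction w arbitrary: i) (auto intro!: sum_nonneg)

lemma lists_length_Suc: "{w. length w = Suc n} = (\<lambda>(x, w). x # w) ` (UNIV \<times> {w. length w = n})"
  by (auto simp: length_Suc_conv image_iff)

lemma inj_on_Cons_pair: "inj_on (\<lambda>(x, w). x # w) S"
  by (auto simp: inj_on_def)

lemma sum_lists_length_Suc:
  "(\<Sum>h\<in>{h. length h = Suc n}. f h) = (\<Sum>x\<in>UNIV. \<Sum>h\<in>{h. length h = n}. f (x # h))"
  unfolding lists_length_Suc sum.reindex[OF inj_on_Cons_pair]
  by (simp add: sum.cartesian_product split_beta)

text \<open>Fubini over the first letter. The alphabet may be infinite; nonnegativity turns the
  iterated sums into summability over pairs.\<close>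

lemma has_sum_lists_length_Suc:
  fixes f :: "'a list \<Rightarrow> real"
  assumes "\<And>x. ((\<lambda>w. f (x # w)) has_sum g x) {w. length w = n}" and "(g has_sum S) UNIV"
    and "\<And>w. f w \<ge> 0"
  shows "(f has_sum S) {w. length w = Suc n}"
proof -
  let ?f = "f \<circ> (\<lambda>(x, w). x # w)"
  have "?f summable_on (UNIV \<times> {w. length w = n})"
    using assms by (intro summable_on_SigmaI[where g = g]) (auto simp: has_sum_imp_summable)
  then have "(?f has_sum S) (UNIV \<times> {w. length w = n})"
    using assms by (intro has_sum_SigmaI[where g = g]) auto
  then show ?thesis
    unfolding lists_length_Suc has_sum_reindex[OF inj_on_Cons_pair] .
qed

lemma has_sum_sum:
  fixes f :: "'i \<Rightarrow> 'x \<Rightarrow> real"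
  assumes "\<And>i. i \<in> I \<Longrightarrow> (f i has_sum S i) A"
  shows "((\<lambda>x. \<Sum>i\<in>I. f i x) has_sum (\<Sum>i\<in>I. S i)) A"
  using assms by (induction I rule: infinite_finite_induct) (auto intro: has_sum_add)

lemma state_word_prob_eq_sum_paths:
  "state_word_prob T i w =
    (\<Sum>h\<in>{h. length h = length w}. \<Prod>k<length w. pmf (T ((i # h) ! k)) ((i # h) ! Suc k, w ! k))"
proof (induction w arbitrary: i)
  case (Cons x w)
  show ?case
    by (simp add: sum_lists_length_Suc prod.lessThan_Suc_shift Cons sum_distrib_left
        del: prod.lessThan_Suc)
qed simp

lemma hmm_word_prob_eq: "hmm_word_prob T \<pi> w = (\<Sum>i\<in>UNIV. pmf \<pi> i * state_word_prob T i w)"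
  by (simp add: hmm_word_prob_def sum_lists_length_Suc state_word_prob_eq_sum_paths sum_distrib_left)

section \<open>Co-emission sums and the transfer matrix\<close>

lemma summable_on_pmf_mult:
  fixes p :: "('s \<times> 'a) pmf" and q :: "('t \<times> 'a) pmf"
  shows "(\<lambda>x. pmf p (j, x) * pmf q (n, x)) summable_on UNIV"
proof (rule nonneg_bounded_partial_sums_imp_summable_on[where C = 1])
  show "\<forall>\<^sub>F F in finite_subsets_at_top UNIV. (\<Sum>x\<in>F. pmf p (j, x) * pmf q (n, x)) \<le> 1"
  proof (rule eventually_finite_subsets_at_top_weakI)
    \<comment> \<open>Factors of q are at most 1, so the partial sum is bounded by the mass that p
      gives to finitely many pairs.\<close>
    fix F :: "'a set" assume F: "finite F"
    have "(\<Sum>x\<in>F. pmf p (j, x) * pmf q (n, x)) \<le> (\<Sum>x\<in>F. pmf p (j, x))"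
      by (intro sum_mono mult_right_le_one_le) (auto simp: pmf_le_1)
    also have "\<dots> = (\<Sum>z\<in>Pair j ` F. pmf p z)"
      by (simp add: sum.reindex inj_on_def)
    also have "\<dots> \<le> 1"
      using F by (simp add: measure_measure_pmf_finite[symmetric])
    finally show "(\<Sum>x\<in>F. pmf p (j, x) * pmf q (n, x)) \<le> 1" .
  qed
qed simp

text \<open>Summability makes the \<open>infsum\<close> in \<open>transfer_matrix\<close> a genuine
  sum rather than the default value 0.\<close>

lemma has_sum_transfer_matrix:
  "((\<lambda>x. pmf (T i) (fst c, x) * pmf (U m) (snd c, x)) has_sum transfer_matrix T U $ (i, m) $ c) UNIV"
  by (simp add: transfer_matrix_def summable_on_pmf_mult)

lemma transfer_matrix_nonneg: "transfer_matrix T U $ r $ c \<ge> 0"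
  by (simp add: transfer_matrix_def infsum_nonneg)

text \<open>When both models emit the same letter, the pair of hidden states moves with weight given
  by an entry of the transfer matrix, after summing over that letter. Each further letter thus costs
  one factor of the matrix.\<close>

lemma has_sum_state_word_prob_mult:
  "((\<lambda>w. state_word_prob T i w * state_word_prob U m w) has_sum
     (((*v) (transfer_matrix T U) ^^ L) 1) $ (i, m)) {w. length w = L}"
proof (induction L arbitrary: i m)
  case 0
  then show ?case by (intro has_sum_finiteI) simp_all
next
  case (Suc L)
  let ?v = "((*v) (transfer_matrix T U) ^^ L) 1"
  let ?a = "\<lambda>x c. pmf (T i) (fst c, x) * pmf (U m) (snd c, x)"
  show ?case
  proof (rule has_sum_lists_length_Suc)
    fix x
    have eq: "state_word_prob T i (x # w) * state_word_prob U m (x # w) =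
        (\<Sum>c\<in>UNIV. ?a x c * (state_word_prob T (fst c) w * state_word_prob U (snd c) w))" for w
      by (simp add: sum_product sum.cartesian_product split_beta mult_ac)
    show "((\<lambda>w. state_word_prob T i (x # w) * state_word_prob U m (x # w)) has_sum
        (\<Sum>c\<in>UNIV. ?a x c * ?v $ c)) {w. length w = L}"
      unfolding eq
    proof (intro has_sum_sum has_sum_cmult_right)
      fix c show "((\<lambda>w. state_word_prob T (fst c) w * state_word_prob U (snd c) w) has_sum
          ?v $ c) {w. length w = L}"
        using Suc[of "fst c" "snd c"] by simp
    qed
  next
    have "((\<lambda>x. \<Sum>c\<in>UNIV. ?a x c * ?v $ c) has_sum
        (\<Sum>c\<in>UNIV. transfer_matrix T U $ (i, m) $ c * ?v $ c)) UNIV"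
      by (intro has_sum_sum has_sum_cmult_left has_sum_transfer_matrix)
    then show "((\<lambda>x. \<Sum>c\<in>UNIV. ?a x c * ?v $ c) has_sum
        (((*v) (transfer_matrix T U) ^^ Suc L) 1) $ (i, m)) UNIV"
      by (simp add: matrix_vector_mult_def)
  qed (simp add: state_word_prob_nonneg)
qed

text \<open>The two models start independently, so the initial pair has weight \<pi> times \<rho>.
  Stating it with \<open>has_sum\<close> also records the summability that positivity of the
  self-terms relies on.\<close>

lemma has_sum_coemission:
  assumes "hmm_representation T \<pi> P" "hmm_representation U \<rho> Q"
  shows "((\<lambda>w. word_prob P w * word_prob Q w) has_sum
     total_mass (\<lambda>r. pmf \<pi> (fst r) * pmf \<rho> (snd r)) (transfer_matrix T U) L) {w. length w = L}"
proof -
  have eq: "word_prob P w * word_prob Q w = (\<Sum>r\<in>UNIV. pmf \<pi> (fst r) * pmf \<rho> (snd r) *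
        (state_word_prob T (fst r) w * state_word_prob U (snd r) w))" for w
    using assms
    by (simp add: hmm_representation_def hmm_word_prob_eq sum_product sum.cartesian_product
        split_beta mult_ac)
  show ?thesis
    unfolding eq total_mass_def
  proof (intro has_sum_sum has_sum_cmult_right)
    fix r show "((\<lambda>w. state_word_prob T (fst r) w * state_word_prob U (snd r) w) has_sum
        (((*v) (transfer_matrix T U) ^^ L) 1) $ r) {w. length w = L}"
      using has_sum_state_word_prob_mult[of T "fst r" U "snd r" L] by simp
  qed
qed

lemma ex_word_state_prob_pos: "\<exists>w. length w = L \<and> state_word_prob T i w > 0"
proof (induction L arbitrary: i)
  case (Suc L)
  obtain j x where jx: "(j, x) \<in> set_pmf (T i)" using set_pmf_not_empty[of "T i"] by auto
  obtain w where w: "length w = L" "state_word_prob T j w > 0" using Suc by blast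
  have "state_word_prob T i (x # w) > 0"
    using jx w
    by (auto intro!: sum_pos2[of _ j] mult_nonneg_nonneg simp: pmf_positive state_word_prob_nonneg)
  then show ?case using w(1) by (metis length_Cons)
qed simp

text \<open>From a state of positive \<pi>-probability some word of length L can be emitted; the
  square of its probability is one term of the sum.\<close>

lemma coemission_self_pos:
  assumes P: "hmm_representation T \<pi> P"
  shows "coemission_prob P P L > 0"
proof -
  obtain i where i: "pmf \<pi> i > 0" using set_pmf_not_empty[of \<pi>] pmf_positive by fastforce
  obtain w where w: "length w = L" "state_word_prob T i w > 0"
    using ex_word_state_prob_pos by blast
  have "word_prob P w > 0"
    using P i w
    by (auto simp: hmm_representation_def hmm_word_prob_eq state_word_prob_nonneg
        intro!: sum_pos2[of _ i] mult_nonneg_nonneg)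
  then have "0 < word_prob P w * word_prob P w" by simp
  also have "\<dots> = (\<Sum>v\<in>{w}. word_prob P v * word_prob P v)" by simp
  also have "\<dots> \<le> coemission_prob P P L"
    unfolding coemission_prob_def
    using has_sum_coemission[OF P P, of L] w(1)
    by (intro finite_sum_le_infsum) (auto simp: has_sum_imp_summable)
  finally show ?thesis .
qed

text \<open>Serves for the pairs (P,P), (Q,Q) and (P,Q). The first fact also excludes a zero leading
  eigenvalue for the self-terms, and the third makes the logarithm of the mixed term finite.\<close>

lemma coemission_growth:
  assumes "hmm_representation T \<pi> P" "\<And>i. pmf \<pi> i > 0"
    and "hmm_representation U \<rho> Q" "\<And>m. pmf \<rho> m > 0"
  defines "\<mu> \<equiv> leading_eigenvalue (transfer_matrix T U)"
  shows "\<mu> = 0 \<Longrightarrow> \<forall>\<^sub>F L in sequentially. coemission_prob P Q L = 0"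
    and "\<mu> > 0 \<Longrightarrow> (\<lambda>L. log 2 (coemission_prob P Q L) / real L) \<longlonglongrightarrow> log 2 \<mu>"
    and "\<mu> > 0 \<Longrightarrow> coemission_prob P Q L > 0"
proof -
  let ?w = "\<lambda>r. pmf \<pi> (fst r) * pmf \<rho> (snd r)"
  have eq: "coemission_prob P Q L = total_mass ?w (transfer_matrix T U) L" for L
    unfolding coemission_prob_def using has_sum_coemission[OF assms(1,3)] by (rule infsumI)
  have w: "?w r > 0" for r using assms by simp
  show "\<mu> = 0 \<Longrightarrow> \<forall>\<^sub>F L in sequentially. coemission_prob P Q L = 0"
    unfolding eq \<mu>_def by (rule total_mass_eventually_0)
  have "\<exists>c>0. \<forall>L. c * \<mu> ^ L \<le> coemission_prob P Q L"
    unfolding eq \<mu>_def by (rule total_mass_lower[OF transfer_matrix_nonneg w])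
  then obtain c where c: "c > 0" "\<And>L. c * \<mu> ^ L \<le> coemission_prob P Q L"
    by blast
  show "\<mu> > 0 \<Longrightarrow> coemission_prob P Q L > 0"
    using c(1) c(2)[of L] by (meson less_le_trans mult_pos_pos zero_less_power)
  show "\<mu> > 0 \<Longrightarrow> (\<lambda>L. log 2 (coemission_prob P Q L) / real L) \<longlonglongrightarrow> log 2 \<mu>"
  proof (rule log_over_n_tendsto[OF _ c])
    show "\<exists>K. \<forall>L. coemission_prob P Q L \<le> K * s ^ L" if "s > \<mu>" for s
      using that unfolding eq \<mu>_def by (rule total_mass_upper[OF w])
  qed
qed

section \<open>The divergence rate\<close>

lemma elog2_ratio:
  assumes "x > 0" "y > 0" "z > 0"
  shows "elog2 (x / sqrt (y * z)) = ereal (log 2 x - (log 2 y + log 2 z) / 2)"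
proof -
  have "log 2 (sqrt (y * z)) = (log 2 y + log 2 z) / 2"
    using assms by (simp add: log_def ln_sqrt ln_mult add_divide_distrib)
  then show ?thesis using assms by (simp add: elog2_def log_divide)
qed

theorem corollary1:
  fixes P Q :: "(int \<Rightarrow> 'a::countable) measure"
    and T :: "'s::finite \<Rightarrow> ('s \<times> 'a) pmf" and \<pi> :: "'s pmf"
    and U :: "'t::finite \<Rightarrow> ('t \<times> 'a) pmf" and \<rho> :: "'t pmf"
  assumes "process P" "stationary P" "ergodic P"
    and "process Q" "stationary Q" "ergodic Q"
    and "hmm_representation T \<pi> P" "\<And>i. pmf \<pi> i > 0"
    and "hmm_representation U \<rho> Q" "\<And>m. pmf \<rho> m > 0"
  shows "convergent (coemission_rate_seq P Q) \<and>
         coemission_divergence_rate P Q =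
           - (ereal (1 / 2) *
              elog2 (leading_eigenvalue (transfer_matrix T U) /
                     (sqrt (leading_eigenvalue (transfer_matrix T T)) *
                      sqrt (leading_eigenvalue (transfer_matrix U U)))))"
proof -
  let ?m = "leading_eigenvalue (transfer_matrix T U)"
    and ?p = "leading_eigenvalue (transfer_matrix T T)"
    and ?q = "leading_eigenvalue (transfer_matrix U U)"
  let ?l = "ereal (1 / 2) * elog2 (?m / (sqrt ?p * sqrt ?q))"
  note PP = coemission_growth[OF assms(7,8) assms(7,8)]
    and QQ = coemission_growth[OF assms(9,10) assms(9,10)]
    and PQ = coemission_growth[OF assms(7-10)]
  note Cp = coemission_self_pos[OF assms(7)] and Cq = coemission_self_pos[OF assms(9)]
  \<comment> \<open>A positive sequence is not eventually 0; with the positive self-terms this rules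
    out \<open>?p = 0\<close> and \<open>?q = 0\<close>.\<close>
  have nz: "\<not> (\<forall>\<^sub>F L in sequentially. f L = 0)" if "\<And>L. f L > 0" for f :: "nat \<Rightarrow> real"
  proof -
    have "f L = 0 \<longleftrightarrow> False" for L using that[of L] by simp
    then show ?thesis by simp
  qed
  have "?p \<noteq> 0" "?q \<noteq> 0"
    using PP(1) QQ(1) nz[of "coemission_prob P P", OF Cp] nz[of "coemission_prob Q Q", OF Cq] by argo+
  then have p: "?p > 0" and q: "?q > 0"
    using leading_eigenvalue_nonneg[of "transfer_matrix T T"]
      leading_eigenvalue_nonneg[of "transfer_matrix U U"] by linarith+
  have "coemission_rate_seq P Q \<longlonglongrightarrow> ?l"
  proof (cases "?m = 0")
    \<comment> \<open>Both sides are minus infinity from some L on. L = 0 must be excluded: there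
      the prefactor is 1 / 0 = 0, and 0 times minus infinity is 0 in \<open>ereal\<close>.\<close>
    case True
    have "\<forall>\<^sub>F L in sequentially. coemission_rate_seq P Q L = ?l"
      using PQ(1)[OF True] eventually_gt_at_top[of 0]
      by eventually_elim (simp add: coemission_rate_seq_def elog2_def True)
    then show ?thesis by (rule tendsto_eventually)
  next
    case False
    then have m: "?m > 0" using leading_eigenvalue_nonneg[of "transfer_matrix T U"] by simp
    let ?a = "\<lambda>L. log 2 (coemission_prob P Q L) / real L"
      and ?b = "\<lambda>L. log 2 (coemission_prob P P L) / real L"
      and ?c = "\<lambda>L. log 2 (coemission_prob Q Q L) / real L"
    have "(\<lambda>L. (?a L - (?b L + ?c L) / 2) / 2) \<longlonglongrightarrow>
        (log 2 ?m - (log 2 ?p + log 2 ?q) / 2) / 2"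
      by (intro tendsto_intros PQ(2) PP(2) QQ(2) m p q) simp_all
    then have "(\<lambda>L. ereal ((?a L - (?b L + ?c L) / 2) / 2)) \<longlonglongrightarrow>
        ereal ((log 2 ?m - (log 2 ?p + log 2 ?q) / 2) / 2)"
      by (rule tendsto_ereal)
    moreover have "ereal ((log 2 ?m - (log 2 ?p + log 2 ?q) / 2) / 2) = ?l"
      using elog2_ratio[OF m p q] by (simp add: real_sqrt_mult)
    \<comment> \<open>This holds at L = 0 too: division by zero makes both sides 0, as the logarithm
      is finite here.\<close>
    moreover have "ereal ((?a L - (?b L + ?c L) / 2) / 2) = coemission_rate_seq P Q L" for L
      by (simp add: coemission_rate_seq_def elog2_ratio[OF PQ(3)[OF m] Cp Cq])
        (simp add: diff_divide_distrib add_divide_distrib mult.commute)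
    ultimately show ?thesis by simp
  qed
  then show ?thesis
    by (auto simp: convergent_def coemission_divergence_rate_def limI)
qed

end
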